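(* $\chi(G^2)\le 3\Delta(G)+2$ for every circular-arc graph $G$.
   Context: All graphs are finite and simple. $\Delta(G)$ is the maximum degree of $G$ and $\chi$ denotes the chromatic number. The square $G^2$ is the graph on $V(G)$ in which two distinct vertices are adjacent iff their distance in $G$ is at most $2$. $G$ is a circular-arc graph if it is the intersection graph of arcs on a circle: each vertex can be assigned an arc of a circle so that two distinct vertices are adjacent iff their arcs intersect. *)

theory Defs
  imports "HOL-Analysis.Analysis" "Graph_Theory.Pair_Digraph" "Graph_Theory.Shortest_Path"
begin

text \<open>A finite simple graph is a \<^locale>\<open>pair_graph\<close>: finite, loop-free, with a symmetric arc
  relation, each edge being represented by its two orientations. Hence \<^const>\<open>out_degree\<close> counts
  neighbours.\<close>

text \<open>On \<^typ>\<open>nat\<close> the supremum of the empty set is 0, so the graph without vertices has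
  maximum degree 0.\<close>

definition max_degree :: "'a pair_pre_digraph \<Rightarrow> nat" where
  "max_degree G = (SUP v\<in>pverts G. out_degree (with_proj G) v)"

text \<open>The length of a shortest walk; it is infinite between different components.\<close>

definition graph_dist :: "'a pair_pre_digraph \<Rightarrow> 'a \<Rightarrow> 'a \<Rightarrow> ereal" where
  "graph_dist G u v = wf_digraph.\<mu> (with_proj G) (\<lambda>_. 1) u v"

definition square :: "'a pair_pre_digraph \<Rightarrow> 'a pair_pre_digraph" where
  "square G = \<lparr> pverts = pverts G,
     parcs = {(u, v). u \<in> pverts G \<and> v \<in> pverts G \<and> u \<noteq> v \<and> graph_dist G u v \<le> 2} \<rparr>"

definition proper_colouring :: "'a pair_pre_digraph \<Rightarrow> nat \<Rightarrow> ('a \<Rightarrow> nat) \<Rightarrow> bool" where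
  "proper_colouring G k c \<longleftrightarrow>
     (\<forall>v\<in>pverts G. c v < k) \<and> (\<forall>(u, v)\<in>parcs G. c u \<noteq> c v)"

definition chromatic_number :: "'a pair_pre_digraph \<Rightarrow> nat" where
  "chromatic_number G = (LEAST k. \<exists>c. proper_colouring G k c)"

text \<open>The circle is the unit circle of the complex plane, and arcs are the images of nonempty real
  intervals under the angle parametrisation. Open, closed and half-open arcs are all admitted, as
  are single points and the full circle; for finite graphs each of the usual conventions
  (only closed arcs, only open arcs, only proper arcs) yields the same class of intersection
  graphs.\<close>

definition circle_arc :: "complex set \<Rightarrow> bool" where
  "circle_arc A \<longleftrightarrow> (\<exists>I :: real set. is_interval I \<and> I \<noteq> {} \<and> A = cis ` I)"

definition circular_arc_graph :: "'a pair_pre_digraph \<Rightarrow> bool" where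
  "circular_arc_graph G \<longleftrightarrow>
     (\<exists>A. (\<forall>v\<in>pverts G. circle_arc (A v)) \<and>
          (\<forall>u\<in>pverts G. \<forall>v\<in>pverts G. u \<noteq> v \<longrightarrow>
             ((u, v) \<in> parcs G \<longleftrightarrow> A u \<inter> A v \<noteq> {})))"

text \<open>The minimum in the chromatic number is attained, and squares are again finite simple
  graphs.\<close>

lemma ex_proper_colouring:
  assumes "pair_graph G"
  shows "\<exists>k c. proper_colouring G k c"
proof -
  interpret pair_graph G by fact
  obtain c :: "'a \<Rightarrow> nat" and n where c: "c ` pverts G = {i. i < n}" "inj_on c (pverts G)"
    using finite_imp_inj_to_nat_seg[OF pair_finite_verts] by blast
  have "proper_colouring G n c"
    unfolding proper_colouring_def
  proof (intro conjI ballI)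
    show "c v < n" if "v \<in> pverts G" for v using c that by auto
    show "case e of (u, v) \<Rightarrow> c u \<noteq> c v" if "e \<in> parcs G" for e
      using c(2) pair_no_loops[OF that] arc_fst_in_verts[OF that] arc_snd_in_verts[OF that]
      by (auto dest: inj_onD split: prod.splits)
  qed
  then show ?thesis by blast
qed

lemma graph_dist_le_2_iff:
  assumes "pair_graph G" "u \<noteq> v"
  shows "graph_dist G u v \<le> 2 \<longleftrightarrow>
    (u, v) \<in> parcs G \<or> (\<exists>w. (u, w) \<in> parcs G \<and> (w, v) \<in> parcs G)"
proof -
  interpret pair_graph G by fact
  have cost: "awalk_cost (\<lambda>_. 1) p = real (length p)" for p :: "('a \<times> 'a) list"
    by (induction p) auto
  have d: "graph_dist G u v = (INF p\<in>{p. awalk u p v}. ereal (real (length p)))"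
    unfolding graph_dist_def \<mu>_def cost ..
  show ?thesis
  proof
    assume "graph_dist G u v \<le> 2"
    then have "(INF p\<in>{p. awalk u p v}. ereal (real (length p))) < ereal 3"
      unfolding d by (rule order_le_less_trans) simp
    then obtain p where p: "awalk u p v" "length p < 3"
      unfolding INF_less_iff by auto
    then consider "p = []" | e where "p = [e]" | e f where "p = [e, f]"
      by (cases p; cases "tl p"; cases "tl (tl p)") auto
    then show "(u, v) \<in> parcs G \<or> (\<exists>w. (u, w) \<in> parcs G \<and> (w, v) \<in> parcs G)"
      using p(1) assms(2) by cases (auto simp: awalk_def)
  next
    assume "(u, v) \<in> parcs G \<or> (\<exists>w. (u, w) \<in> parcs G \<and> (w, v) \<in> parcs G)"
    then obtain p where p: "awalk u p v" "length p \<le> 2"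
    proof (elim disjE exE conjE)
      assume "(u, v) \<in> parcs G"
      then show ?thesis using arc_fst_in_verts[of "(u, v)"]
        by (intro that[of "[(u, v)]"]) (auto simp: awalk_def)
    next
      fix w assume "(u, w) \<in> parcs G" "(w, v) \<in> parcs G"
      then show ?thesis using arc_fst_in_verts[of "(u, w)"]
        by (intro that[of "[(u, w), (w, v)]"]) (auto simp: awalk_def)
    qed
    then have "graph_dist G u v \<le> ereal (real (length p))"
      unfolding d by (intro INF_lower) auto
    also have "\<dots> \<le> 2" using p(2) by simp
    finally show "graph_dist G u v \<le> 2" .
  qed
qed

lemma pair_graph_square:
  assumes "pair_graph G"
  shows "pair_graph (square G)"
proof -
  interpret pair_graph G by fact
  have sym: "(v, u) \<in> parcs G" if "(u, v) \<in> parcs G" for u v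
    using that pair_sym_arcs by (auto simp: symmetric_def dest: symD)
  have sub: "parcs (square G) \<subseteq> pverts G \<times> pverts G"
    by (auto simp: square_def)
  show ?thesis
  proof
    show "finite (parcs (square G))"
      using sub pair_finite_verts by (meson finite_SigmaI finite_subset)
    show "symmetric (with_proj (square G))"
      unfolding symmetric_def arcs_ends_def arc_to_ends_def
      using graph_dist_le_2_iff[OF assms] sym
      by (auto intro!: symI simp: square_def with_proj_def image_iff) metis+
  qed (use pair_finite_verts in \<open>auto simp: square_def\<close>)
qed

end

theory Submission
  imports Defs
begin

text \<open>The square is \<open>2\<Delta>\<close>-degenerate. Given a nonempty set \<open>S\<close> of vertices, choose
  \<open>x \<in> S\<close> whose arc is minimal under inclusion. Among the arcs meeting that of \<open>x\<close>, let \<open>w\<^sub>1\<close> and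
  \<open>w\<^sub>2\<close> be those reaching farthest beyond \<open>x\<close> in the two directions. A vertex of \<open>S\<close> at
  distance at most 2 from \<open>x\<close> has either the same arc as \<open>x\<close> or, by minimality, meets an arc in
  the closed neighbourhood of \<open>x\<close> at a point outside the arc of \<open>x\<close>; hence it meets \<open>w\<^sub>1\<close> or \<open>w\<^sub>2\<close>.
  Since \<open>x\<close> meets both of them too, at most \<open>2\<Delta>\<close> such vertices remain, and greedy colouring
  uses at most \<open>2\<Delta> + 1\<close> colours.\<close>

section \<open>Greedy colouring of degenerate graphs\<close>

lemma greedy_colouring:
  fixes R :: "'a \<Rightarrow> 'a \<Rightarrow> bool"
  assumes "finite V"
    and sym: "\<And>u v. R u v \<Longrightarrow> R v u"
    and irrefl: "\<And>v. \<not> R v v"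
    and degenerate: "\<And>S. S \<subseteq> V \<Longrightarrow> S \<noteq> {} \<Longrightarrow> \<exists>x\<in>S. card {y\<in>S. R x y} < k"
  shows "\<exists>c :: 'a \<Rightarrow> nat. (\<forall>v\<in>V. c v < k) \<and> (\<forall>u\<in>V. \<forall>v\<in>V. R u v \<longrightarrow> c u \<noteq> c v)"
  using \<open>finite V\<close>
proof (induction rule: finite_remove_induct)
  case empty
  show ?case by simp
next
  case (remove S)
  \<comment> \<open>\<open>x\<close> is coloured last: its fewer than \<open>k\<close> neighbours in
    \<open>S\<close> leave a colour free.\<close>
  then obtain x where x: "x \<in> S" "card {y\<in>S. R x y} < k"
    using degenerate by blast
  with remove.IH obtain c :: "'a \<Rightarrow> nat"
    where c: "\<forall>v\<in>S - {x}. c v < k" "\<forall>u\<in>S - {x}. \<forall>v\<in>S - {x}. R u v \<longrightarrow> c u \<noteq> c v"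
    by blast
  have "card (c ` {y\<in>S. R x y}) < card {..<k}"
    using x(2) card_image_le[of "{y\<in>S. R x y}" c] remove.hyps by simp
  then have "\<not> {..<k} \<subseteq> c ` {y\<in>S. R x y}"
    using remove.hyps(1) card_mono[of "c ` {y\<in>S. R x y}" "{..<k}"] by auto
  then obtain a where a: "a < k" "a \<notin> c ` {y\<in>S. R x y}"
    by blast
  \<comment> \<open>Irreflexivity keeps \<open>x\<close> out of its own neighbour set, so
    recolouring \<open>x\<close> leaves the avoided colours unchanged; symmetry covers pairs with
    \<open>x\<close> in second place.\<close>
  have "R u v \<longrightarrow> (c(x := a)) u \<noteq> (c(x := a)) v" if "u \<in> S" "v \<in> S" for u v
    using a(2) c(2) that sym irrefl by (cases "u = x"; cases "v = x") auto
  moreover have "\<forall>v\<in>S. (c(x := a)) v < k"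
    using a(1) c(1) by auto
  ultimately show ?case by blast
qed

section \<open>Arcs of the circle and how far they reach\<close>

lemma finite_chain_has_greatest:
  fixes f :: "'a \<Rightarrow> 'b set"
  assumes "finite S" "S \<noteq> {}" and "\<And>u v. u \<in> S \<Longrightarrow> v \<in> S \<Longrightarrow> f u \<subseteq> f v \<or> f v \<subseteq> f u"
  shows "\<exists>w\<in>S. \<forall>v\<in>S. f v \<subseteq> f w"
proof -
  obtain M where M: "M \<in> f ` S" "\<forall>B\<in>f ` S. M \<subseteq> B \<longrightarrow> M = B"
    using finite_has_maximal[of "f ` S"] assms(1,2) by auto
  then show ?thesis
    using assms(3) by fastforce
qed

text \<open>Translating an interval by a multiple of \<open>2 * pi\<close> keeps its image under
  \<open>cis\<close>. An arc can thus be lifted through a prescribed parameter and compared on the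
  real line with the interval of another arc.\<close>

lemma circle_arc_lift:
  assumes "circle_arc A" "cis i \<in> A"
  obtains J where "is_interval J" "i \<in> J" "A = cis ` J"
proof -
  obtain K where K: "is_interval K" "A = cis ` K"
    using assms(1) by (auto simp: circle_arc_def)
  then obtain s where s: "s \<in> K" "cis i = cis s"
    using assms(2) by auto
  then have "sin i = sin s \<and> cos i = cos s"
    by (simp add: complex_eq_iff)
  then obtain n :: int where n: "i = s + 2 * pi * n"
    unfolding sin_cos_eq_iff by blast
  have per: "cis (2 * pi * n + t) = cis t" for t
    by (simp flip: cis_mult)
  show thesis
  proof
    show "is_interval ((+) (2 * pi * n) ` K)"
      using K(1) by (simp add: is_interval_translation)
    show "i \<in> (+) (2 * pi * n) ` K"
      using s(1) n by auto
    show "A = cis ` (+) (2 * pi * n) ` K"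
      by (simp add: K(2) image_image per)
  qed
qed

lemma two_arcs_meet_all_escaping:
  assumes "finite V" "x \<in> V" and arc: "\<And>v. v \<in> V \<Longrightarrow> circle_arc (A v)"
  obtains w\<^sub>1 w\<^sub>2 where "w\<^sub>1 \<in> V" "A w\<^sub>1 \<inter> A x \<noteq> {}" "w\<^sub>2 \<in> V" "A w\<^sub>2 \<inter> A x \<noteq> {}"
    and "\<And>w. w \<in> V \<Longrightarrow> A w \<inter> A x \<noteq> {} \<Longrightarrow> A w \<subseteq> A x \<union> A w\<^sub>1 \<union> A w\<^sub>2"
proof -
  define N where "N = {w\<in>V. A w \<inter> A x \<noteq> {}}"
  obtain I where I: "is_interval I" "I \<noteq> {}" "A x = cis ` I"
    using arc[OF \<open>x \<in> V\<close>] by (auto simp: circle_arc_def)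
  \<comment> \<open>\<open>L w\<close> measures how far \<open>A w\<close> reaches to the left of
    \<open>I\<close>, and \<open>R w\<close> to the right. Sets of parameters in place of endpoints
    treat open, closed and unbounded intervals alike.\<close>
  define L where "L w = {t. (\<forall>i\<in>I. t < i) \<and> (\<exists>i\<in>I. cis ` {t..i} \<subseteq> A w)}" for w
  define R where "R w = {t. (\<forall>i\<in>I. i < t) \<and> (\<exists>i\<in>I. cis ` {i..t} \<subseteq> A w)}" for w
  have "finite N" "N \<noteq> {}"
    using assms I by (auto simp: N_def)
  have L_closed: "t' \<in> L w" if "t \<in> L w" "t \<le> t'" "\<forall>i\<in>I. t' < i" for t t' w
    using that by (fastforce simp: L_def)
  have R_closed: "t' \<in> R w" if "t \<in> R w" "t' \<le> t" "\<forall>i\<in>I. i < t'" for t t' w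
    using that by (fastforce simp: R_def)
  \<comment> \<open>Of two parameters separating \<open>L u\<close> from \<open>L v\<close>, the one
    nearer to \<open>I\<close> would lie in both, by \<open>L_closed\<close>.\<close>
  have "L u \<subseteq> L v \<or> L v \<subseteq> L u" for u v
  proof (rule ccontr)
    assume "\<not> ?thesis"
    then obtain s t where "s \<in> L u" "s \<notin> L v" "t \<in> L v" "t \<notin> L u" by blast
    moreover have "\<forall>i\<in>I. s < i" "\<forall>i\<in>I. t < i"
      using \<open>s \<in> L u\<close> \<open>t \<in> L v\<close> by (simp_all add: L_def)
    ultimately show False
      using L_closed[of s u t] L_closed[of t v s] by (cases "s \<le> t") auto
  qed
  then obtain w\<^sub>1 where w\<^sub>1: "w\<^sub>1 \<in> N" "\<forall>w\<in>N. L w \<subseteq> L w\<^sub>1"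
    using finite_chain_has_greatest[OF \<open>finite N\<close> \<open>N \<noteq> {}\<close>, of L] by blast
  have "R u \<subseteq> R v \<or> R v \<subseteq> R u" for u v
  proof (rule ccontr)
    assume "\<not> ?thesis"
    then obtain s t where "s \<in> R u" "s \<notin> R v" "t \<in> R v" "t \<notin> R u" by blast
    moreover have "\<forall>i\<in>I. i < s" "\<forall>i\<in>I. i < t"
      using \<open>s \<in> R u\<close> \<open>t \<in> R v\<close> by (simp_all add: R_def)
    ultimately show False
      using R_closed[of t v s] R_closed[of s u t] by (cases "s \<le> t") auto
  qed
  then obtain w\<^sub>2 where w\<^sub>2: "w\<^sub>2 \<in> N" "\<forall>w\<in>N. R w \<subseteq> R w\<^sub>2"
    using finite_chain_has_greatest[OF \<open>finite N\<close> \<open>N \<noteq> {}\<close>, of R] by blast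
  have "A w \<subseteq> A x \<union> A w\<^sub>1 \<union> A w\<^sub>2" if w: "w \<in> N" for w
  proof
    fix q assume q: "q \<in> A w"
    obtain i where i: "i \<in> I" "cis i \<in> A w"
      using w I(3) by (auto simp: N_def)
    \<comment> \<open>Lifting through the common parameter \<open>i\<close> makes \<open>J\<close>
      overlap \<open>I\<close>.\<close>
    obtain J where J: "is_interval J" "i \<in> J" "A w = cis ` J"
      using circle_arc_lift[OF arc i(2)] w by (auto simp: N_def)
    obtain t where t: "t \<in> J" "q = cis t"
      using q J(3) by auto
    have between: "b \<in> K" if "is_interval K" "a \<in> K" "c \<in> K" "a \<le> b" "b \<le> c"
      for K and a b c :: real
      using mem_is_interval_1_I that by blast
    \<comment> \<open>As \<open>I\<close> is an interval, a parameter outside it lies to one side of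
      all of \<open>I\<close>, and \<open>J\<close> contains the stretch between it and
      \<open>i\<close>.\<close>
    consider "t \<in> I" | "t \<notin> I" "t < i" | "t \<notin> I" "i < t"
      using i(1) by fastforce
    then show "q \<in> A x \<union> A w\<^sub>1 \<union> A w\<^sub>2"
    proof cases
      case 1
      then show ?thesis using I(3) t(2) by simp
    next
      case 2
      have "\<forall>j\<in>I. t < j"
        using 2 between[OF I(1) _ i(1), of _ t] by (meson less_imp_le not_le)
      moreover have "cis ` {t..i} \<subseteq> A w"
        using between[OF J(1) t(1) J(2)] J(3) by auto
      ultimately have "t \<in> L w" using i(1) by (auto simp: L_def)
      then have "t \<in> L w\<^sub>1" using w w\<^sub>1(2) by blast
      then have "cis t \<in> A w\<^sub>1" by (force simp: L_def)
      then show ?thesis using t(2) by simp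
    next
      case 3
      have "\<forall>j\<in>I. j < t"
        using 3 between[OF I(1) i(1), of _ t] by (meson less_imp_le not_le)
      moreover have "cis ` {i..t} \<subseteq> A w"
        using between[OF J(1) J(2) t(1)] J(3) by auto
      ultimately have "t \<in> R w" using i(1) by (auto simp: R_def)
      then have "t \<in> R w\<^sub>2" using w w\<^sub>2(2) by blast
      then have "cis t \<in> A w\<^sub>2" by (force simp: R_def)
      then show ?thesis using t(2) by simp
    qed
  qed
  then show thesis
    using w\<^sub>1(1) w\<^sub>2(1) by (intro that[of w\<^sub>1 w\<^sub>2]) (auto simp: N_def)
qed

section \<open>Counting neighbours in the square\<close>

lemma card_neighbours_le_max_degree:
  assumes "pair_graph G" "w \<in> pverts G"
  shows "card {v. (w, v) \<in> parcs G} \<le> max_degree G"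
proof -
  interpret pair_graph G by fact
  have "out_arcs (with_proj G) w = Pair w ` {v. (w, v) \<in> parcs G}"
    by (auto simp: out_arcs_def)
  then have "out_degree (with_proj G) w = card {v. (w, v) \<in> parcs G}"
    by (simp add: out_degree_def card_image inj_on_def)
  moreover have "out_degree (with_proj G) w \<le> max_degree G"
    unfolding max_degree_def
    using assms(2) pair_finite_verts by (intro cSUP_upper) auto
  ultimately show ?thesis by simp
qed

lemma chromatic_number_square_circular_arc_le:
  assumes "pair_graph G" and "circular_arc_graph G"
  shows "chromatic_number (square G) \<le> 2 * max_degree G + 1"
proof -
  interpret pair_graph G by fact
  let ?V = "pverts G"
  obtain A where A: "\<forall>v\<in>?V. circle_arc (A v)"
    "\<forall>u\<in>?V. \<forall>v\<in>?V. u \<noteq> v \<longrightarrow> ((u, v) \<in> parcs G \<longleftrightarrow> A u \<inter> A v \<noteq> {})"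
    using assms(2) unfolding circular_arc_graph_def by (elim exE conjE)
  have arc: "circle_arc (A v)" if "v \<in> ?V" for v
    using A(1) that by simp
  have adj: "(u, v) \<in> parcs G \<longleftrightarrow> A u \<inter> A v \<noteq> {}" if "u \<in> ?V" "v \<in> ?V" "u \<noteq> v" for u v
    using A(2) that by simp
  have nonempty: "A v \<noteq> {}" if "v \<in> ?V" for v
    using arc[OF that] by (auto simp: circle_arc_def)
  have in_verts: "u \<in> ?V \<and> v \<in> ?V" if "(u, v) \<in> parcs G" for u v
    using arc_fst_in_verts[OF that] arc_snd_in_verts[OF that] by simp
  \<comment> \<open>Leaving out \<open>x\<close> makes the bound exact: for \<open>w\<close> other
    than \<open>x\<close>, the set counts \<open>w\<close> itself, which is not its own neighbour,
    but omits the neighbour \<open>x\<close>.\<close>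
  have meeting_card: "card {y\<in>?V. y \<noteq> x \<and> A w \<inter> A y \<noteq> {}} \<le> max_degree G"
    if "x \<in> ?V" "w \<in> ?V" "A w \<inter> A x \<noteq> {}" for x w
  proof -
    let ?N = "{v. (w, v) \<in> parcs G}"
    have "finite ?N"
      using in_verts pair_finite_verts by (auto intro: finite_subset[of _ ?V])
    show ?thesis
    proof (cases "w = x")
      case True
      have "{y\<in>?V. y \<noteq> x \<and> A w \<inter> A y \<noteq> {}} \<subseteq> ?N"
        using True adj[OF that(2)] by blast
      then show ?thesis
        using card_mono[OF \<open>finite ?N\<close>] card_neighbours_le_max_degree[OF assms(1) that(2)]
        by (meson order_trans)
    next
      case False
      have "x \<in> ?N"
        using adj[OF that(2,1) False] that(3) by simp
      have "{y\<in>?V. y \<noteq> x \<and> A w \<inter> A y \<noteq> {}} \<subseteq> insert w (?N - {x})"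
        using adj[OF that(2)] by blast
      then have "card {y\<in>?V. y \<noteq> x \<and> A w \<inter> A y \<noteq> {}} \<le> card (insert w (?N - {x}))"
        using \<open>finite ?N\<close> by (intro card_mono) auto
      also have "\<dots> \<le> Suc (card (?N - {x}))"
        by (rule card_insert_le_m1) simp_all
      also have "\<dots> = card ?N"
        using \<open>finite ?N\<close> \<open>x \<in> ?N\<close> by (rule card_Suc_Diff1)
      also have "\<dots> \<le> max_degree G"
        by (rule card_neighbours_le_max_degree[OF assms(1) that(2)])
      finally show ?thesis .
    qed
  qed
  interpret sq: pair_graph "square G"
    by (rule pair_graph_square[OF assms(1)])
  define D where "D u v \<longleftrightarrow> (u, v) \<in> parcs (square G)" for u v
  have D_sym: "D v u" if "D u v" for u v
    using that sq.pair_sym_arcs by (auto simp: D_def symmetric_def dest: symD)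
  have D_irrefl: "\<not> D v v" for v
    by (simp add: D_def square_def)
  \<comment> \<open>Both distances take one form: for adjacent \<open>u\<close> and
    \<open>v\<close>, the witness \<open>w\<close> is \<open>u\<close>, whose nonempty arc meets
    itself.\<close>
  have D_arcs: "v \<in> ?V \<and> v \<noteq> u \<and> (\<exists>w\<in>?V. A w \<inter> A u \<noteq> {} \<and> A w \<inter> A v \<noteq> {})"
    if "D u v" for u v
  proof -
    have uv: "u \<in> ?V" "v \<in> ?V" "u \<noteq> v" "graph_dist G u v \<le> 2"
      using that by (auto simp: D_def square_def)
    from uv(4) have "(u, v) \<in> parcs G \<or> (\<exists>w. (u, w) \<in> parcs G \<and> (w, v) \<in> parcs G)"
      using graph_dist_le_2_iff[OF assms(1) uv(3)] by simp
    then have "\<exists>w\<in>?V. A w \<inter> A u \<noteq> {} \<and> A w \<inter> A v \<noteq> {}"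
    proof (elim disjE exE conjE)
      assume "(u, v) \<in> parcs G"
      then show ?thesis
        using adj[OF uv(1-3)] nonempty[OF uv(1)] uv(1) by (intro bexI[of _ u]) auto
    next
      fix w assume w: "(u, w) \<in> parcs G" "(w, v) \<in> parcs G"
      have "w \<in> ?V" "u \<noteq> w" "w \<noteq> v"
        using in_verts[OF w(1)] pair_no_loops[OF w(1)] pair_no_loops[OF w(2)] by simp_all
      then show ?thesis
        using w adj[of u w] adj[of w v] uv(1,2) by (intro bexI[of _ w]) auto
    qed
    then show ?thesis using uv by auto
  qed
  have "\<exists>x\<in>S. card {y\<in>S. D x y} < 2 * max_degree G + 1" if S: "S \<subseteq> ?V" "S \<noteq> {}" for S
  proof -
    have "finite S" using S(1) pair_finite_verts by (rule finite_subset)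
    then obtain M where "M \<in> A ` S" and M: "\<forall>B\<in>A ` S. B \<subseteq> M \<longrightarrow> M = B"
      using finite_has_minimal[of "A ` S"] S(2) by auto
    then obtain x where x: "x \<in> S" "M = A x" by auto
    have minimal: "A y = A x" if "y \<in> S" "A y \<subseteq> A x" for y
      using M that x(2) by auto
    have "x \<in> ?V" using S x by auto
    \<comment> \<open>The two arcs come from all of \<open>?V\<close>, since the middle vertex of a
      path between members of \<open>S\<close> may lie outside \<open>S\<close>.\<close>
    obtain w\<^sub>1 w\<^sub>2 where w\<^sub>1: "w\<^sub>1 \<in> ?V" "A w\<^sub>1 \<inter> A x \<noteq> {}"
      and w\<^sub>2: "w\<^sub>2 \<in> ?V" "A w\<^sub>2 \<inter> A x \<noteq> {}"
      and cover: "\<And>w. w \<in> ?V \<Longrightarrow> A w \<inter> A x \<noteq> {} \<Longrightarrow> A w \<subseteq> A x \<union> A w\<^sub>1 \<union> A w\<^sub>2"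
      by (rule two_arcs_meet_all_escaping[of ?V x A])
        (use pair_finite_verts \<open>x \<in> ?V\<close> arc in simp_all)
    let ?N = "\<lambda>w. {y\<in>?V. y \<noteq> x \<and> A w \<inter> A y \<noteq> {}}"
    have "{y\<in>S. D x y} \<subseteq> ?N w\<^sub>1 \<union> ?N w\<^sub>2"
    proof
      fix y assume "y \<in> {y\<in>S. D x y}"
      then have y: "y \<in> S" "D x y" by simp_all
      from D_arcs[OF y(2)] obtain w where yV: "y \<in> ?V" "y \<noteq> x"
        and w: "w \<in> ?V" "A w \<inter> A x \<noteq> {}" "A w \<inter> A y \<noteq> {}"
        by blast
      have "A y \<inter> A w\<^sub>1 \<noteq> {} \<or> A y \<inter> A w\<^sub>2 \<noteq> {}"
      proof (cases "A y = A x")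
        case True
        then show ?thesis using w\<^sub>1(2) by auto
      next
        case False
        then obtain p where p: "p \<in> A y" "p \<notin> A x"
          using minimal y(1) by blast
        show ?thesis
        \<comment> \<open>If \<open>A y\<close> misses \<open>A x\<close>, its common point with
          \<open>A w\<close> lies outside \<open>A x\<close>, so \<open>cover\<close> for
          \<open>w\<close> applies. Otherwise \<open>y\<close> itself meets \<open>x\<close>, and
          \<open>cover\<close> for \<open>y\<close> places \<open>p\<close> in one of the two
          arcs.\<close>
        proof (cases "A y \<inter> A x = {}")
          case True
          then show ?thesis using w(3) cover[OF w(1,2)] by blast
        next
          case False
          then show ?thesis using p cover[OF yV(1)] by blast
        qed
      qed
      then show "y \<in> ?N w\<^sub>1 \<union> ?N w\<^sub>2" using yV by blast
    qed
    then have "card {y\<in>S. D x y} \<le> card (?N w\<^sub>1 \<union> ?N w\<^sub>2)"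
      using pair_finite_verts by (intro card_mono) auto
    also have "\<dots> \<le> card (?N w\<^sub>1) + card (?N w\<^sub>2)"
      by (rule card_Un_le)
    also have "\<dots> \<le> max_degree G + max_degree G"
      using meeting_card[OF \<open>x \<in> ?V\<close> w\<^sub>1] meeting_card[OF \<open>x \<in> ?V\<close> w\<^sub>2] by (rule add_mono)
    finally show ?thesis using x(1) by force
  qed
  from greedy_colouring[of ?V D, OF pair_finite_verts D_sym D_irrefl this]
  obtain c :: "'a \<Rightarrow> nat" where
    "\<forall>v\<in>?V. c v < 2 * max_degree G + 1" "\<forall>u\<in>?V. \<forall>v\<in>?V. D u v \<longrightarrow> c u \<noteq> c v"
    by blast
  then have "proper_colouring (square G) (2 * max_degree G + 1) c"
    unfolding proper_colouring_def by (auto simp: square_def D_def)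
  then show ?thesis
    unfolding chromatic_number_def by (blast intro: Least_le)
qed

theorem corollary13:
  fixes G :: "'a pair_pre_digraph"
  assumes "pair_graph G" and "circular_arc_graph G"
  shows "chromatic_number (square G) \<le> 3 * max_degree G + 2"
  \<comment> \<open>The degeneracy bound \<open>2 * max_degree G + 1\<close> is at most the required
    one, even for maximum degree 0.\<close>
  using chromatic_number_square_circular_arc_le[OF assms] by simp

end
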